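(* Let $T$ be a set of cardinality greater than $\aleph_0$, $\mathcal{A}$ a $\sigma$-algebra of subsets of $T$, $X$ a Banach space, and $F:T\to b(X)$ a multifunction. Let $\mu:\mathcal{A}\to[0,\infty)$ be a set function with $\mu(\emptyset)=0$ and $\mu(T)>0$ which is $\sigma$-null-null-additive and monotone, and let $A\in\mathcal{A}$ be an atom of $\mu$. Then $F$ is Birkhoff simple integrable on $A$ with respect to $\mu$ if and only if $F$ is Gould integrable on $A$ with respect to $\mu$, and in this case $$(G)\int_A F\,d\mu=(B_s)\int_A F\,d\mu .$$
   Context: $(X,\|\cdot\|)$ is a Banach space; $b(X)$ is the family of nonempty bounded subsets of $X$ and $bf(X)$ the family of nonempty closed bounded subsets of $X$. For nonempty $A,B\subset X$ put $e(A,B)=\sup_{x\in A}\inf_{y\in B}\|x-y\|$ and $h(A,B)=\max\{e(A,B),e(B,A)\}$. Finite sums $\sum$ of subsets of $X$ denote the norm closure of the Minkowski sum. $\mu$ is monotone if $\mu(B)\le\mu(C)$ whenever $B\subset C$ in $\mathcal{A}$; it is $\sigma$-null-null-additive if $\mu(\bigcup_nA_n)=0$ for every sequence $(A_n)$ in $\mathcal{A}$ with $\mu(A_n)=0$ for all $n$. A set $A\in\mathcal{A}$ is an atom of $\mu$ if $\mu(A)>0$ and for every $B\in\mathcal{A}$ with $B\subset A$ one has $\mu(B)=0$ or $\mu(A\setminus B)=0$. No additivity of $\mu$ is otherwise assumed. Partitions: for $A\in\mathcal{A}$, a finite (countable) partition of $A$ is a finite (countable) family of nonempty pairwise disjoint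 members of $\mathcal{A}$ with union $A$. A countable partition may be finite; if it has $N$ members, sums $\sum_{i=1}^n$ over it with $n\ge N$ mean the sum over all $N$ members. $P'\ge P$ ($P'$ finer than $P$) means that every set of $P'$ is included in some set of $P$. Gould integrability on $A$: there is $I\in bf(X)$ such that for every $\varepsilon>0$ there is a finite partition $P_\varepsilon$ of $A$ such that for every finite partition $P=\{A_i\}_{i=1}^n$ of $A$ with $P\ge P_\varepsilon$ and all $t_i\in A_i$, $h(\sum_{i=1}^nF(t_i)\mu(A_i),I)<\varepsilon$. Then $I=(G)\int_AF\,d\mu$. Birkhoff simple integrability on $A$: there is a closed set $I\in b(X)$ such that for every $\varepsilon>0$ there is a countable partition $P_\varepsilon$ of $A$ such that for every countable partition $P=\{A_n\}_{n\in\mathbb{N}}$ of $A$ with $P\ge P_\varepsilon$ (in any enumeration) and all $t_n\in A_n$, $\limsup_nh(\sum_{i=1}^nF(t_i)\mu(A_i),I)\le\varepsilon$. Then $I=(B_s)\int_AF\,d\mu$. *)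

theory Defs
  imports "HOL-Analysis.Analysis" "HOL-Library.Set_Algebras" "HOL-Library.Disjoint_Sets"
begin

text \<open>The excess and the Hausdorff distance are real-valued and only meaningful for nonempty bounded sets, where all suprema and
  infima below exist; they are only applied to such sets.\<close>

definition excess :: "'x::real_normed_vector set \<Rightarrow> 'x set \<Rightarrow> real" where
  "excess A B = (SUP x\<in>A. INF y\<in>B. norm (x - y))"

definition hausdorff_dist :: "'x::real_normed_vector set \<Rightarrow> 'x set \<Rightarrow> real" where
  "hausdorff_dist A B = max (excess A B) (excess B A)"

definition monotone_set_fun :: "'a set set \<Rightarrow> ('a set \<Rightarrow> real) \<Rightarrow> bool" where
  "monotone_set_fun \<A> \<mu> \<longleftrightarrow> (\<forall>B\<in>\<A>. \<forall>C\<in>\<A>. B \<subseteq> C \<longrightarrow> \<mu> B \<le> \<mu> C)"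

definition sigma_null_null_additive :: "'a set set \<Rightarrow> ('a set \<Rightarrow> real) \<Rightarrow> bool" where
  "sigma_null_null_additive \<A> \<mu> \<longleftrightarrow>
     (\<forall>A :: nat \<Rightarrow> 'a set. range A \<subseteq> \<A> \<longrightarrow> (\<forall>n. \<mu> (A n) = 0) \<longrightarrow> \<mu> (\<Union>n. A n) = 0)"

definition is_atom :: "'a set set \<Rightarrow> ('a set \<Rightarrow> real) \<Rightarrow> 'a set \<Rightarrow> bool" where
  "is_atom \<A> \<mu> A \<longleftrightarrow>
     A \<in> \<A> \<and> \<mu> A > 0 \<and> (\<forall>B\<in>\<A>. B \<subseteq> A \<longrightarrow> \<mu> B = 0 \<or> \<mu> (A - B) = 0)"

text \<open>Partitions are sets of sets; \<^const>\<open>partition_on\<close> includes that the members are nonempty.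
  A partition \<open>P\<close> is finer than \<open>Q\<close> iff \<open>refines A P Q\<close>.\<close>

definition finite_partition :: "'a set set \<Rightarrow> 'a set \<Rightarrow> 'a set set \<Rightarrow> bool" where
  "finite_partition \<A> A P \<longleftrightarrow> partition_on A P \<and> P \<subseteq> \<A> \<and> finite P"

definition countable_partition :: "'a set set \<Rightarrow> 'a set \<Rightarrow> 'a set set \<Rightarrow> bool" where
  "countable_partition \<A> A P \<longleftrightarrow> partition_on A P \<and> P \<subseteq> \<A> \<and> countable P"

text \<open>Indices for enumerating a countable family without repetition: \<open>{..<N}\<close> if it has
  \<open>N\<close> members, and all natural numbers if it is infinite.\<close>

definition enum_indices :: "'a set set \<Rightarrow> nat set" where
  "enum_indices P = (if finite P then {..<card P} else UNIV)"

definition enumerates :: "(nat \<Rightarrow> 'a set) \<Rightarrow> 'a set set \<Rightarrow> bool" where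
  "enumerates E P \<longleftrightarrow> bij_betw E (enum_indices P) P"

text \<open>Norm closure of a finite Minkowski sum; the inner sum is the one of
  \<^theory>\<open>HOL-Library.Set_Algebras\<close>.\<close>

definition closed_sum :: "('i \<Rightarrow> 'x::real_normed_vector set) \<Rightarrow> 'i set \<Rightarrow> 'x set" where
  "closed_sum S J = closure (\<Sum>j\<in>J. S j)"

text \<open>The members of a partition are pairwise different, so they serve as their own indices, and a
  choice of points is a function \<open>t\<close> on the members.\<close>

definition has_Gould_integral ::
    "'a set set \<Rightarrow> ('a set \<Rightarrow> real) \<Rightarrow> ('a \<Rightarrow> 'x::real_normed_vector set) \<Rightarrow> 'a set \<Rightarrow> 'x set \<Rightarrow> bool" where
  "has_Gould_integral \<A> \<mu> F A I \<longleftrightarrow>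
     I \<noteq> {} \<and> bounded I \<and> closed I \<and>
     (\<forall>\<epsilon>>0. \<exists>P\<^sub>\<epsilon>. finite_partition \<A> A P\<^sub>\<epsilon> \<and>
        (\<forall>P t. finite_partition \<A> A P \<and> refines A P P\<^sub>\<epsilon> \<and> (\<forall>B\<in>P. t B \<in> B) \<longrightarrow>
           hausdorff_dist (closed_sum (\<lambda>B. (\<lambda>x. \<mu> B *\<^sub>R x) ` F (t B)) P) I < \<epsilon>))"

definition Gould_integrable ::
    "'a set set \<Rightarrow> ('a set \<Rightarrow> real) \<Rightarrow> ('a \<Rightarrow> 'x::real_normed_vector set) \<Rightarrow> 'a set \<Rightarrow> bool" where
  "Gould_integrable \<A> \<mu> F A \<longleftrightarrow> (\<exists>I. has_Gould_integral \<A> \<mu> F A I)"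

text \<open>When \<open>\<A>\<close> is a sigma-algebra and \<open>F\<close> has nonempty bounded values,
  there is at most one such \<open>I\<close>, since any two
  partitions have a common refinement and the Hausdorff distance separates closed bounded sets.
  The same holds for the Birkhoff simple integral.\<close>

definition Gould_integral ::
    "'a set set \<Rightarrow> ('a set \<Rightarrow> real) \<Rightarrow> ('a \<Rightarrow> 'x::real_normed_vector set) \<Rightarrow> 'a set \<Rightarrow> 'x set" where
  "Gould_integral \<A> \<mu> F A = (THE I. has_Gould_integral \<A> \<mu> F A I)"

text \<open>Intersecting \<open>{..<n}\<close> with the index set makes the partial sums of a finite partition stay
  constant once all of its members are used. The upper limit is taken in \<^typ>\<open>ereal\<close>, as
  \<^const>\<open>limsup\<close> needs a complete lattice.\<close>

definition has_Birkhoff_simple_integral ::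
    "'a set set \<Rightarrow> ('a set \<Rightarrow> real) \<Rightarrow> ('a \<Rightarrow> 'x::real_normed_vector set) \<Rightarrow> 'a set \<Rightarrow> 'x set \<Rightarrow> bool" where
  "has_Birkhoff_simple_integral \<A> \<mu> F A I \<longleftrightarrow>
     I \<noteq> {} \<and> bounded I \<and> closed I \<and>
     (\<forall>\<epsilon>>0. \<exists>P\<^sub>\<epsilon>. countable_partition \<A> A P\<^sub>\<epsilon> \<and>
        (\<forall>P E t. countable_partition \<A> A P \<and> refines A P P\<^sub>\<epsilon> \<and> enumerates E P \<and>
             (\<forall>i\<in>enum_indices P. t i \<in> E i) \<longrightarrow>
           limsup (\<lambda>n. ereal (hausdorff_dist
             (closed_sum (\<lambda>i. (\<lambda>x. \<mu> (E i) *\<^sub>R x) ` F (t i)) ({..<n} \<inter> enum_indices P)) I))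
           \<le> ereal \<epsilon>))"

definition Birkhoff_simple_integrable ::
    "'a set set \<Rightarrow> ('a set \<Rightarrow> real) \<Rightarrow> ('a \<Rightarrow> 'x::real_normed_vector set) \<Rightarrow> 'a set \<Rightarrow> bool" where
  "Birkhoff_simple_integrable \<A> \<mu> F A \<longleftrightarrow> (\<exists>I. has_Birkhoff_simple_integral \<A> \<mu> F A I)"

definition Birkhoff_simple_integral ::
    "'a set set \<Rightarrow> ('a set \<Rightarrow> real) \<Rightarrow> ('a \<Rightarrow> 'x::real_normed_vector set) \<Rightarrow> 'a set \<Rightarrow> 'x set" where
  "Birkhoff_simple_integral \<A> \<mu> F A = (THE I. has_Birkhoff_simple_integral \<A> \<mu> F A I)"

end

theory Submission
  imports Defs
begin

text \<open>Every countable partition of an atom has exactly one member of positive measure: not all members can be null by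
  \<open>\<sigma>\<close>-null-null-additivity, and the complement in the atom of a member of positive measure is null, hence so are
  the other members. A Gould or Birkhoff sum therefore collapses to the single closed set \<open>cl (\<mu>(B) F(t))\<close>
  with \<open>B\<close> the charged member, and both integrals become the limit of these sets as \<open>B\<close> shrinks
  along the charged subsets of the atom.\<close>

section \<open>Closed Minkowski sums, refinements and enumerations\<close>

text \<open>The singleton \<open>{0}\<close> is the neutral element of Minkowski addition, so all
  summands except the one at \<open>k\<close> disappear before the closure is taken.\<close>

lemma closed_sum_single:
  fixes S :: "'i \<Rightarrow> 'x::real_normed_vector set"
  assumes "finite J" and "k \<in> J" and "\<And>j. j \<in> J \<Longrightarrow> j \<noteq> k \<Longrightarrow> S j = {0}"
  shows "closed_sum S J = closure (S k)"
proof -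
  have "(\<Sum>j\<in>J - {k}. S j) = 0"
    by (rule sum.neutral) (use assms(3) in auto)
  then show ?thesis
    using assms(1,2) by (simp add: closed_sum_def sum.remove)
qed

text \<open>Cutting \<open>C\<close> into \<open>B\<close> and \<open>C - B\<close> forces a
  prescribed set \<open>B\<close> into a finer partition. Removing \<open>{}\<close> covers the case
  \<open>B = C\<close>, where the family is \<open>P\<close> again.\<close>

lemma refines_split:
  assumes "partition_on A P" and "C \<in> P" and "B \<subseteq> C" and "B \<noteq> {}"
  shows "refines A ({B, C - B} - {{}} \<union> (P - {C})) P"
proof -
  have "partition_on A ({B, C - B} - {{}} \<union> (P - {C}))"
  proof (rule partition_onI)
    show "\<Union> ({B, C - B} - {{}} \<union> (P - {C})) = A"
    proof -
      have Diff_empty_Union: "\<Union> (S - {{}}) = \<Union> S" for S :: "'a set set"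
        by auto
      have "\<Union> ({B, C - B} - {{}} \<union> (P - {C})) = (B \<union> (C - B)) \<union> \<Union> (P - {C})"
        by (subst Union_Un_distrib, subst Diff_empty_Union) simp
      also have "\<dots> = C \<union> \<Union> (P - {C})"
        using assms(3) by (simp add: Un_absorb1)
      also have "\<dots> = \<Union> P"
        using assms(2) by auto
      finally show ?thesis
        using partition_onD1[OF assms(1)] by simp
    qed
    have dj: "X \<inter> Y = {}" if "X \<in> P" "Y \<in> P" "X \<noteq> Y" for X Y
      using partition_onD2[OF assms(1)] that by (auto simp: disjoint_def)
    show "disjnt X Y"
      if "X \<in> {B, C - B} - {{}} \<union> (P - {C})" "Y \<in> {B, C - B} - {{}} \<union> (P - {C})" "X \<noteq> Y" for X Y
    proof -
      have "disjnt X C" if "X \<in> P - {C}" for X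
        using dj[of X C] that assms(2) by (auto simp: disjnt_def)
      then have "disjnt X B \<and> disjnt X (C - B)" if "X \<in> P - {C}" for X
        using that assms(3) disjnt_subset2 by (metis Diff_subset)
      moreover have "disjnt B (C - B)"
        by (auto simp: disjnt_def)
      moreover have "disjnt X Y" if "X \<in> P" "Y \<in> P"
        using dj[OF that \<open>X \<noteq> Y\<close>] by (simp add: disjnt_def)
      ultimately show ?thesis
        using that by (elim UnE DiffE insertE emptyE) (simp_all add: disjnt_sym)
    qed
    show "{} \<notin> {B, C - B} - {{}} \<union> (P - {C})"
      using partition_onD3[OF assms(1)] assms(4) by auto
  qed
  then show ?thesis
    using assms by (auto simp: refines_def)
qed

lemma finite_imp_countable_partition:
  "finite_partition \<A> A P \<Longrightarrow> countable_partition \<A> A P"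
  by (simp add: finite_partition_def countable_partition_def countable_finite)

text \<open>The Birkhoff condition speaks of enumerated partitions; this makes it applicable to a
  partition that was built as a set of sets.\<close>

lemma enumerates_exists:
  assumes "countable P"
  obtains E where "enumerates E P"
proof (cases "finite P")
  case True
  then obtain E where "bij_betw E {0..<card P} P"
    using ex_bij_betw_nat_finite by blast
  then show ?thesis
    using that True by (simp add: enumerates_def enum_indices_def atLeast0LessThan)
next
  case False
  then show ?thesis
    using that bij_betw_from_nat_into[OF assms False] by (simp add: enumerates_def enum_indices_def)
qed

section \<open>Null and charged subsets of an atom\<close>

locale null_null_atom = sigma_algebra T \<A> for T :: "'a set" and \<A> :: "'a set set" +
  fixes \<mu> :: "'a set \<Rightarrow> real" and A :: "'a set"
  assumes nonneg: "B \<in> \<A> \<Longrightarrow> 0 \<le> \<mu> B"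
    and empty: "\<mu> {} = 0"
    and null_null_additive: "sigma_null_null_additive \<A> \<mu>"
    and monotone: "monotone_set_fun \<A> \<mu>"
    and atom: "is_atom \<A> \<mu> A"
begin

text \<open>As \<open>C\<close> is charged, the atom property applied to \<open>C\<close> leaves
  only \<mu>(A - C) = 0, and monotonicity passes this on to every measurable subset of
  \<open>A - C\<close>.\<close>

lemma null_complement:
  assumes "C \<in> \<A>" "C \<subseteq> A" "\<mu> C > 0" and "B \<in> \<A>" "B \<subseteq> A - C"
  shows "\<mu> B = 0"
proof -
  have "A - C \<in> \<A>" "\<mu> (A - C) = 0"
    using atom assms unfolding is_atom_def by auto
  then show ?thesis
    using monotone assms(4,5) nonneg[OF assms(4)] unfolding monotone_set_fun_def
    by (metis order_antisym)
qed

lemma charged_member: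
  assumes P: "countable_partition \<A> A P"
  obtains C where "C \<in> P" "C \<in> \<A>" "C \<subseteq> A" "\<mu> C > 0" "\<And>B. B \<in> P \<Longrightarrow> B \<noteq> C \<Longrightarrow> \<mu> B = 0"
proof -
  have part: "partition_on A P" "P \<subseteq> \<A>" "countable P"
    using P by (auto simp: countable_partition_def)
  have "\<mu> A > 0"
    using atom by (simp add: is_atom_def)
  then have "P \<noteq> {}"
    using partition_onD1[OF part(1)] empty by auto
  \<comment> \<open>\<open>from_nat_into\<close> lists a nonempty countable \<open>P\<close> along
    all natural numbers, with repetitions if \<open>P\<close> is finite. Hence
    \<sigma>-null-null-additivity, which is stated for sequences, covers finite and infinite
    partitions at once.\<close>
  then have range: "range (from_nat_into P) = P"
    using part(3) by (rule range_from_nat_into)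
  have "\<exists>C\<in>P. \<mu> C \<noteq> 0"
  proof (rule ccontr)
    assume "\<not> ?thesis"
    then have "\<mu> (from_nat_into P n) = 0" for n
      using range by auto
    then have "\<mu> (\<Union>n. from_nat_into P n) = 0"
      using null_null_additive range part(2) unfolding sigma_null_null_additive_def by blast
    then show False
      using range partition_onD1[OF part(1)] \<open>\<mu> A > 0\<close> by simp
  qed
  then obtain C where C: "C \<in> P" "\<mu> C \<noteq> 0"
    by blast
  then have C': "C \<in> \<A>" "C \<subseteq> A" "\<mu> C > 0"
    using part(2) nonneg[of C] partition_onD1[OF part(1)] by auto
  have "\<mu> B = 0" if "B \<in> P" "B \<noteq> C" for B
  proof (rule null_complement[OF C'])
    show "B \<in> \<A>"
      using that part(2) by auto
    show "B \<subseteq> A - C"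
      using partition_onD1[OF part(1)] partition_onD2[OF part(1)] that C(1)
      by (auto simp: disjoint_def)
  qed
  then show ?thesis
    using that C(1) C' by blast
qed

text \<open>Nonempty values matter here: the image of an empty set would be empty instead of
  \<open>{0}\<close> and would make the whole Minkowski sum empty.\<close>

lemma scaled_null:
  assumes "\<mu> B = 0" "t \<in> A" and F: "\<And>t. t \<in> A \<Longrightarrow> F t \<noteq> {}"
  shows "(\<lambda>x. \<mu> B *\<^sub>R x) ` F t = {0 :: 'x::real_normed_vector}"
  using assms by auto

text \<open>Convergence in Hausdorff distance along the charged subsets of the atom, ordered by
  reverse inclusion and uniform in the tag. Partitions do not occur in it, so it can serve as a
  common description of both integrals.\<close>

definition charged_limit :: "('a \<Rightarrow> 'x::real_normed_vector set) \<Rightarrow> 'x set \<Rightarrow> bool" where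
  "charged_limit F I \<longleftrightarrow> (\<forall>\<epsilon>>0. \<exists>C\<in>\<A>. C \<subseteq> A \<and> \<mu> C > 0 \<and>
     (\<forall>B\<in>\<A>. B \<subseteq> C \<longrightarrow> \<mu> B > 0 \<longrightarrow>
       (\<forall>t\<in>B. hausdorff_dist (closure ((\<lambda>x. \<mu> B *\<^sub>R x) ` F t)) I < \<epsilon>)))"

section \<open>Collapse of the Gould and Birkhoff sums\<close>

lemma Gould_sum:
  fixes F :: "'a \<Rightarrow> 'x::real_normed_vector set"
  assumes F: "\<And>t. t \<in> A \<Longrightarrow> F t \<noteq> {}"
    and P: "finite_partition \<A> A P" and t: "\<And>B. B \<in> P \<Longrightarrow> t B \<in> B"
    and C: "C \<in> P" "\<mu> C > 0"
  shows "closed_sum (\<lambda>B. (\<lambda>x. \<mu> B *\<^sub>R x) ` F (t B)) P = closure ((\<lambda>x. \<mu> C *\<^sub>R x) ` F (t C))"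
proof (rule closed_sum_single)
  show "finite P"
    using P by (simp add: finite_partition_def)
  show "(\<lambda>x. \<mu> B *\<^sub>R x) ` F (t B) = {0}" if "B \<in> P" "B \<noteq> C" for B
  proof (rule scaled_null[OF _ _ F])
    show "\<mu> B = 0"
      \<comment> \<open>The charged member supplied by \<open>charged_member\<close> must be
        \<open>C\<close>, since every other member is null and \<open>C\<close> is not.\<close>
      using charged_member[OF finite_imp_countable_partition[OF P]] that C by (metis less_irrefl)
    show "t B \<in> A"
      using t[OF that(1)] that(1) P by (auto simp: finite_partition_def partition_on_def)
  qed
qed fact

text \<open>The partial sums are constant from the index of the charged member on.\<close>

lemma Birkhoff_sum_limsup:
  fixes F :: "'a \<Rightarrow> 'x::real_normed_vector set"
  assumes F: "\<And>t. t \<in> A \<Longrightarrow> F t \<noteq> {}"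
    and P: "countable_partition \<A> A P" and E: "enumerates E P"
    and t: "\<And>i. i \<in> enum_indices P \<Longrightarrow> t i \<in> E i"
    and k: "k \<in> enum_indices P" "\<mu> (E k) > 0"
  shows "limsup (\<lambda>n. ereal (hausdorff_dist
      (closed_sum (\<lambda>i. (\<lambda>x. \<mu> (E i) *\<^sub>R x) ` F (t i)) ({..<n} \<inter> enum_indices P)) I)) =
    ereal (hausdorff_dist (closure ((\<lambda>x. \<mu> (E k) *\<^sub>R x) ` F (t k))) I)"
proof -
  have bij: "bij_betw E (enum_indices P) P"
    using E by (simp add: enumerates_def)
  have "(\<lambda>x. \<mu> (E i) *\<^sub>R x) ` F (t i) = {0}" if "i \<in> enum_indices P" "i \<noteq> k" for i
  proof (rule scaled_null[OF _ _ F])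
    \<comment> \<open>Injectivity of the enumeration turns different indices into different
      members.\<close>
    have mem: "E i \<in> P" "E k \<in> P" "E i \<noteq> E k"
      using bij that k(1) by (auto simp: bij_betw_def inj_on_def)
    then show "\<mu> (E i) = 0"
      using charged_member[OF P] k(2) by (metis less_irrefl)
    show "t i \<in> A"
      using t[OF that(1)] mem(1) P by (auto simp: countable_partition_def partition_on_def)
  qed
  \<comment> \<open>The index \<open>k\<close> belongs to \<open>{..<n}\<close> exactly when
    \<open>n > k\<close>, hence the strict bound.\<close>
  then have "closed_sum (\<lambda>i. (\<lambda>x. \<mu> (E i) *\<^sub>R x) ` F (t i)) ({..<n} \<inter> enum_indices P) =
      closure ((\<lambda>x. \<mu> (E k) *\<^sub>R x) ` F (t k))" if "n > k" for n
    using that k(1) by (intro closed_sum_single) auto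
  then have "\<forall>\<^sub>F n in sequentially. ereal (hausdorff_dist
      (closed_sum (\<lambda>i. (\<lambda>x. \<mu> (E i) *\<^sub>R x) ` F (t i)) ({..<n} \<inter> enum_indices P)) I) =
    ereal (hausdorff_dist (closure ((\<lambda>x. \<mu> (E k) *\<^sub>R x) ` F (t k))) I)"
    by (intro eventually_mono[OF eventually_gt_at_top[of k]]) simp
  from Limsup_eq[OF this] show ?thesis
    by (simp add: Limsup_const)
qed

section \<open>Partitions adapted to a charged set\<close>

text \<open>Used to pass from an integral to \<open>charged_limit\<close>: any charged
  \<open>B\<close> inside a member of \<open>P\<close> becomes the charged member of a partition
  finer than \<open>P\<close>. Finiteness is preserved, so the construction serves both
  integrals.\<close>

lemma split_partition:
  assumes P: "countable_partition \<A> A P" and C: "C \<in> P" and B: "B \<in> \<A>" "B \<subseteq> C" "\<mu> B > 0"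
  obtains Q where "countable_partition \<A> A Q" "refines A Q P" "B \<in> Q" "finite P \<Longrightarrow> finite Q"
proof
  let ?Q = "{B, C - B} - {{}} \<union> (P - {C})"
  have "B \<noteq> {}"
    using B(3) empty by auto
  then show ref: "refines A ?Q P" and "B \<in> ?Q"
    using refines_split[of A P C B] P C B(2) by (auto simp: countable_partition_def)
  show "countable_partition \<A> A ?Q"
    using ref P C B by (auto simp: countable_partition_def refines_def)
qed simp

text \<open>Used to pass from \<open>charged_limit\<close> to an integral. In a refinement of the
  partition into \<open>C\<close> and \<open>A - C\<close>, a measurable member inside
  \<open>A - C\<close> is null, so a charged one lies in \<open>C\<close>. Removing
  \<open>{}\<close> covers \<open>C = A\<close>.\<close>

lemma two_set_partition:
  assumes C: "C \<in> \<A>" "C \<subseteq> A" "\<mu> C > 0"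
  obtains Q where "finite_partition \<A> A Q"
    "\<And>P B. refines A P Q \<Longrightarrow> B \<in> P \<Longrightarrow> B \<in> \<A> \<Longrightarrow> \<mu> B > 0 \<Longrightarrow> B \<subseteq> C"
proof
  let ?Q = "{C, A - C} - {{}}"
  have "A \<in> \<A>"
    using atom by (simp add: is_atom_def)
  then show "finite_partition \<A> A ?Q"
    using C by (auto simp: finite_partition_def partition_on_def disjoint_def)
  show "B \<subseteq> C" if "refines A P ?Q" "B \<in> P" "B \<in> \<A>" "\<mu> B > 0" for P B
  proof -
    have "B \<subseteq> C \<or> B \<subseteq> A - C"
      using that(1,2) by (auto simp: refines_def)
    then show ?thesis
      using null_complement[OF C that(3)] that(4) by auto
  qed
qed

section \<open>Both integrals as limits along charged sets\<close>

text \<open>From left to right, a charged subset \<open>B\<close> of the charged member of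
  \<open>P0\<close> is completed to a partition finer than \<open>P0\<close>, whose Gould sum is the
  single term at \<open>B\<close>. From right to left, the partition into \<open>C\<close> and
  \<open>A - C\<close> serves as the required one.\<close>

lemma has_Gould_integral_iff:
  fixes F :: "'a \<Rightarrow> 'x::real_normed_vector set"
  assumes F: "\<And>t. t \<in> A \<Longrightarrow> F t \<noteq> {}"
  shows "has_Gould_integral \<A> \<mu> F A I \<longleftrightarrow> I \<noteq> {} \<and> bounded I \<and> closed I \<and> charged_limit F I"
    (is "?L \<longleftrightarrow> ?R")
proof
  assume L: ?L
  have "charged_limit F I"
    unfolding charged_limit_def
  proof (intro allI impI)
    fix \<epsilon> :: real assume "\<epsilon> > 0"
    obtain P0 where P0: "finite_partition \<A> A P0" and
      le: "\<forall>P t. finite_partition \<A> A P \<and> refines A P P0 \<and> (\<forall>B\<in>P. t B \<in> B) \<longrightarrow>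
        hausdorff_dist (closed_sum (\<lambda>B. (\<lambda>x. \<mu> B *\<^sub>R x) ` F (t B)) P) I < \<epsilon>"
      using L[unfolded has_Gould_integral_def, THEN conjunct2, THEN conjunct2, THEN conjunct2,
          THEN spec, THEN mp, OF \<open>\<epsilon> > 0\<close>]
      by (elim exE conjE) (rule that)
    obtain C where C: "C \<in> P0" "C \<in> \<A>" "C \<subseteq> A" "\<mu> C > 0"
      by (rule charged_member[OF finite_imp_countable_partition[OF P0]]) (rule that)
    have "hausdorff_dist (closure ((\<lambda>x. \<mu> B *\<^sub>R x) ` F s)) I < \<epsilon>"
      if B: "B \<in> \<A>" "B \<subseteq> C" "\<mu> B > 0" and s: "s \<in> B" for B s
    proof -
      obtain Q where Q: "countable_partition \<A> A Q" "refines A Q P0" "B \<in> Q" "finite Q"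
        by (rule split_partition[OF finite_imp_countable_partition[OF P0] C(1) B])
          (rule that, use P0 in \<open>auto simp: finite_partition_def\<close>)
      then have fin: "finite_partition \<A> A Q"
        by (simp add: finite_partition_def countable_partition_def)
      \<comment> \<open>The tag at \<open>B\<close> is the prescribed point; the other members are
        null, so any choice of points in them gives the same sum.\<close>
      define t where "t = (\<lambda>D. SOME x. x \<in> D)(B := s)"
      have t: "t D \<in> D" if "D \<in> Q" for D
        using that s partition_onD3[of A Q] fin
        by (auto simp: t_def finite_partition_def some_in_eq)
      have "hausdorff_dist (closed_sum (\<lambda>B. (\<lambda>x. \<mu> B *\<^sub>R x) ` F (t B)) Q) I < \<epsilon>"
        using le fin Q(2) t by blast
      moreover have "closed_sum (\<lambda>B. (\<lambda>x. \<mu> B *\<^sub>R x) ` F (t B)) Q =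
          closure ((\<lambda>x. \<mu> B *\<^sub>R x) ` F (t B))"
        by (rule Gould_sum[OF F fin t Q(3) B(3)])
      ultimately show ?thesis
        by (simp add: t_def)
    qed
    then show "\<exists>C\<in>\<A>. C \<subseteq> A \<and> \<mu> C > 0 \<and> (\<forall>B\<in>\<A>. B \<subseteq> C \<longrightarrow> \<mu> B > 0 \<longrightarrow>
       (\<forall>t\<in>B. hausdorff_dist (closure ((\<lambda>x. \<mu> B *\<^sub>R x) ` F t)) I < \<epsilon>))"
      using C by blast
  qed
  then show ?R
    using L by (simp add: has_Gould_integral_def)
next
  assume R: ?R
  show ?L
    unfolding has_Gould_integral_def
  proof (intro conjI allI impI)
    fix \<epsilon> :: real assume "\<epsilon> > 0"
    with R obtain C where C: "C \<in> \<A>" "C \<subseteq> A" "\<mu> C > 0" and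
      le: "\<And>B t. B \<in> \<A> \<Longrightarrow> B \<subseteq> C \<Longrightarrow> \<mu> B > 0 \<Longrightarrow> t \<in> B \<Longrightarrow>
        hausdorff_dist (closure ((\<lambda>x. \<mu> B *\<^sub>R x) ` F t)) I < \<epsilon>"
      unfolding charged_limit_def by meson
    obtain Q where Q: "finite_partition \<A> A Q"
      "\<And>P B. refines A P Q \<Longrightarrow> B \<in> P \<Longrightarrow> B \<in> \<A> \<Longrightarrow> \<mu> B > 0 \<Longrightarrow> B \<subseteq> C"
      by (rule two_set_partition[OF C]) (rule that)
    have "hausdorff_dist (closed_sum (\<lambda>B. (\<lambda>x. \<mu> B *\<^sub>R x) ` F (t B)) P) I < \<epsilon>"
      if P: "finite_partition \<A> A P" "refines A P Q" and t: "\<forall>B\<in>P. t B \<in> B" for P t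
    proof -
      obtain B where B: "B \<in> P" "B \<in> \<A>" "\<mu> B > 0"
        by (rule charged_member[OF finite_imp_countable_partition[OF P(1)]]) (rule that)
      then show ?thesis
        using le[of B "t B"] Q(2)[OF P(2)] Gould_sum[of F P t B] F P(1) t by simp
    qed
    then show "\<exists>P\<^sub>\<epsilon>. finite_partition \<A> A P\<^sub>\<epsilon> \<and>
        (\<forall>P t. finite_partition \<A> A P \<and> refines A P P\<^sub>\<epsilon> \<and> (\<forall>B\<in>P. t B \<in> B) \<longrightarrow>
           hausdorff_dist (closed_sum (\<lambda>B. (\<lambda>x. \<mu> B *\<^sub>R x) ` F (t B)) P) I < \<epsilon>)"
      using Q(1) by blast
  qed (use R in auto)
qed

text \<open>The argument for the Gould integral carries over, with
  \<open>Birkhoff_sum_limsup\<close> in the role of \<open>Gould_sum\<close> and an arbitrary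
  enumeration of the partition.\<close>

lemma has_Birkhoff_simple_integral_iff:
  fixes F :: "'a \<Rightarrow> 'x::real_normed_vector set"
  assumes F: "\<And>t. t \<in> A \<Longrightarrow> F t \<noteq> {}"
  shows "has_Birkhoff_simple_integral \<A> \<mu> F A I \<longleftrightarrow>
    I \<noteq> {} \<and> bounded I \<and> closed I \<and> charged_limit F I"
    (is "?L \<longleftrightarrow> ?R")
proof
  assume L: ?L
  have "charged_limit F I"
    unfolding charged_limit_def
  proof (intro allI impI)
    fix \<epsilon> :: real assume "\<epsilon> > 0"
    \<comment> \<open>The Birkhoff condition bounds the upper limit only by \<open>\<le>\<close>,
      while \<open>charged_limit\<close> asks for a strict inequality; halving \<epsilon> closes
      this gap.\<close>
    then have "\<epsilon> / 2 > 0"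
      by simp
    obtain P0 where P0: "countable_partition \<A> A P0" and
      le: "\<forall>P E t. countable_partition \<A> A P \<and> refines A P P0 \<and> enumerates E P \<and>
        (\<forall>i\<in>enum_indices P. t i \<in> E i) \<longrightarrow>
        limsup (\<lambda>n. ereal (hausdorff_dist
             (closed_sum (\<lambda>i. (\<lambda>x. \<mu> (E i) *\<^sub>R x) ` F (t i)) ({..<n} \<inter> enum_indices P)) I))
           \<le> ereal (\<epsilon> / 2)"
      using L[unfolded has_Birkhoff_simple_integral_def, THEN conjunct2, THEN conjunct2,
          THEN conjunct2, THEN spec, THEN mp, OF \<open>\<epsilon> / 2 > 0\<close>]
      by (elim exE conjE) (rule that)
    obtain C where C: "C \<in> P0" "C \<in> \<A>" "C \<subseteq> A" "\<mu> C > 0"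
      by (rule charged_member[OF P0]) (rule that)
    have "hausdorff_dist (closure ((\<lambda>x. \<mu> B *\<^sub>R x) ` F s)) I < \<epsilon>"
      if B: "B \<in> \<A>" "B \<subseteq> C" "\<mu> B > 0" and s: "s \<in> B" for B s
    proof -
      obtain Q where Q: "countable_partition \<A> A Q" "refines A Q P0" "B \<in> Q"
        by (rule split_partition[OF P0 C(1) B]) (rule that)
      then obtain E where E: "enumerates E Q"
        using enumerates_exists[of Q] by (auto simp: countable_partition_def)
      then obtain k where k: "k \<in> enum_indices Q" "E k = B"
        using Q(3) by (metis enumerates_def bij_betw_imp_surj_on imageE)
      \<comment> \<open>Tags are now indexed by positions, so the prescribed point \<open>s\<close>
        is placed at the position \<open>k\<close> of \<open>B\<close>.\<close>
      define t where "t = (\<lambda>i. SOME x. x \<in> E i)(k := s)"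
      have t: "t i \<in> E i" if "i \<in> enum_indices Q" for i
      proof -
        have "E i \<in> Q"
          using E that by (auto simp: enumerates_def bij_betw_def)
        then have "E i \<noteq> {}"
          using partition_onD3[of A Q] Q(1) by (auto simp: countable_partition_def)
        then show ?thesis
          using k(2) s by (auto simp: t_def some_in_eq)
      qed
      have "\<mu> (E k) > 0"
        using k(2) B(3) by simp
      have "limsup (\<lambda>n. ereal (hausdorff_dist
          (closed_sum (\<lambda>i. (\<lambda>x. \<mu> (E i) *\<^sub>R x) ` F (t i)) ({..<n} \<inter> enum_indices Q)) I))
        \<le> ereal (\<epsilon> / 2)"
        using le Q(1,2) E t by blast
      then have "ereal (hausdorff_dist (closure ((\<lambda>x. \<mu> B *\<^sub>R x) ` F s)) I) \<le> ereal (\<epsilon> / 2)"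
        using Birkhoff_sum_limsup[of F Q E t k I, OF F Q(1) E t k(1) \<open>\<mu> (E k) > 0\<close>]
        by (simp add: t_def k(2))
      then show ?thesis
        using \<open>\<epsilon> > 0\<close> by simp
    qed
    then show "\<exists>C\<in>\<A>. C \<subseteq> A \<and> \<mu> C > 0 \<and> (\<forall>B\<in>\<A>. B \<subseteq> C \<longrightarrow> \<mu> B > 0 \<longrightarrow>
       (\<forall>t\<in>B. hausdorff_dist (closure ((\<lambda>x. \<mu> B *\<^sub>R x) ` F t)) I < \<epsilon>))"
      using C by blast
  qed
  then show ?R
    using L by (simp add: has_Birkhoff_simple_integral_def)
next
  assume R: ?R
  show ?L
    unfolding has_Birkhoff_simple_integral_def
  proof (intro conjI allI impI)
    fix \<epsilon> :: real assume "\<epsilon> > 0"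
    with R obtain C where C: "C \<in> \<A>" "C \<subseteq> A" "\<mu> C > 0" and
      le: "\<And>B t. B \<in> \<A> \<Longrightarrow> B \<subseteq> C \<Longrightarrow> \<mu> B > 0 \<Longrightarrow> t \<in> B \<Longrightarrow>
        hausdorff_dist (closure ((\<lambda>x. \<mu> B *\<^sub>R x) ` F t)) I < \<epsilon>"
      unfolding charged_limit_def by meson
    obtain Q where Q: "finite_partition \<A> A Q"
      "\<And>P B. refines A P Q \<Longrightarrow> B \<in> P \<Longrightarrow> B \<in> \<A> \<Longrightarrow> \<mu> B > 0 \<Longrightarrow> B \<subseteq> C"
      by (rule two_set_partition[OF C]) (rule that)
    have "limsup (\<lambda>n. ereal (hausdorff_dist
        (closed_sum (\<lambda>i. (\<lambda>x. \<mu> (E i) *\<^sub>R x) ` F (t i)) ({..<n} \<inter> enum_indices P)) I)) \<le> ereal \<epsilon>"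
      if P: "countable_partition \<A> A P" "refines A P Q" and E: "enumerates E P"
        and t: "\<forall>i\<in>enum_indices P. t i \<in> E i" for P E t
    proof -
      obtain B where B: "B \<in> P" "B \<in> \<A>" "\<mu> B > 0"
        by (rule charged_member[OF P(1)]) (rule that)
      then obtain k where k: "k \<in> enum_indices P" "E k = B"
        using E by (metis enumerates_def bij_betw_imp_surj_on imageE)
      have "hausdorff_dist (closure ((\<lambda>x. \<mu> B *\<^sub>R x) ` F (t k))) I < \<epsilon>"
        using le[OF B(2) Q(2)[OF P(2) B] B(3)] t k by auto
      then show ?thesis
        using Birkhoff_sum_limsup[of F P E t k I] F P(1) E t k B(3) by simp
    qed
    then show "\<exists>P\<^sub>\<epsilon>. countable_partition \<A> A P\<^sub>\<epsilon> \<and>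
        (\<forall>P E t. countable_partition \<A> A P \<and> refines A P P\<^sub>\<epsilon> \<and> enumerates E P \<and>
             (\<forall>i\<in>enum_indices P. t i \<in> E i) \<longrightarrow>
           limsup (\<lambda>n. ereal (hausdorff_dist
             (closed_sum (\<lambda>i. (\<lambda>x. \<mu> (E i) *\<^sub>R x) ` F (t i)) ({..<n} \<inter> enum_indices P)) I))
           \<le> ereal \<epsilon>)"
      \<comment> \<open>A finite partition is an admissible countable one, so the same two-set
        partition works here.\<close>
      using finite_imp_countable_partition[OF Q(1)] by blast
  qed (use R in auto)
qed

end

section \<open>Agreement of the two integrals\<close>

theorem theorem3p9:
  fixes T :: "'a set" and \<A> :: "'a set set"
    and F :: "'a \<Rightarrow> 'x::banach set"
    and \<mu> :: "'a set \<Rightarrow> real" and A :: "'a set"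
  assumes "uncountable T"
    and "sigma_algebra T \<A>"
    and "\<And>t. t \<in> T \<Longrightarrow> F t \<noteq> {} \<and> bounded (F t)"
    and "\<And>B. B \<in> \<A> \<Longrightarrow> 0 \<le> \<mu> B"
    and "\<mu> {} = 0"
    and "\<mu> T > 0"
    and "sigma_null_null_additive \<A> \<mu>"
    and "monotone_set_fun \<A> \<mu>"
    and "is_atom \<A> \<mu> A"
  shows "(Birkhoff_simple_integrable \<A> \<mu> F A \<longleftrightarrow> Gould_integrable \<A> \<mu> F A) \<and>
    (Gould_integrable \<A> \<mu> F A \<longrightarrow>
       Gould_integral \<A> \<mu> F A = Birkhoff_simple_integral \<A> \<mu> F A)"
proof -
  interpret sigma_algebra T \<A>
    by fact
  interpret null_null_atom T \<A> \<mu> A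
    by unfold_locales (use assms in auto)
  have "A \<subseteq> T"
    using assms(9) sets_into_space by (auto simp: is_atom_def)
  then have F: "F t \<noteq> {}" if "t \<in> A" for t
    using assms(3) that by blast
  \<comment> \<open>Both predicates reduce to the same condition on \<open>I\<close>. Their equality
    as functions transfers to the existence statements and to the \<open>THE\<close> descriptions of
    the integrals.\<close>
  have "has_Gould_integral \<A> \<mu> F A = has_Birkhoff_simple_integral \<A> \<mu> F A"
    by (rule ext) (simp add: has_Gould_integral_iff has_Birkhoff_simple_integral_iff F)
  then show ?thesis
    by (simp add: Gould_integrable_def Birkhoff_simple_integrable_def
        Gould_integral_def Birkhoff_simple_integral_def)
qed

end
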